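(* Let $G$ and $H$ be graphs on $n$ vertices with connected components $G=G_1\cup\cdots\cup G_r$ and $H=H_1\cup\cdots\cup H_s$, and let $d=\max\{\mathrm{diam}(G_i),\mathrm{diam}(H_j)\}$ be the maximum diameter of the connected components. Suppose there is an invertible matrix $S\in\mathbb{C}^{n\times n}$ and $d$ distinct non-zero values of $q$ such that $\mathcal{D}_q^G S = S\mathcal{D}_q^H$ for each of these values of $q$. Then $G$ and $H$ are cospectral for the generalized distance matrix, i.e., $\mathcal{D}_f^G S = S\mathcal{D}_f^H$ (so $\mathcal{D}_f^G$ and $\mathcal{D}_f^H$ have the same spectrum) for every function $f$.
   Context: $\mathrm{dist}(u,v)$ is the length of a shortest path between $u$ and $v$; the diameter of a connected graph is its largest distance. The exponential distance matrix $\mathcal{D}_q^G$ has $(u,v)$ entry $q^{\mathrm{dist}(u,v)}$ (so diagonal entries are $1$); the generalized distance matrix $\mathcal{D}_f^G$ has $(u,v)$ entry $f(\mathrm{dist}(u,v))$. For vertices in different components the distance is $\infty$, and the corresponding entries are taken to be $0$ (i.e., $q^{\infty}=0$ and $f(\infty)=0$). Two graphs are cospectral for a matrix representation if their matrices have the same multiset of eigenvalues. *)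

theory Defs
  imports "Graph_Theory.Graph_Theory" "Jordan_Normal_Form.Char_Poly"
begin

text \<open>
  Finite simple graphs are the symmetric, loop-free digraphs without multi-arcs of the locale
  \<open>graph\<close>. In such a graph the strongly connected components (\<open>pre_digraph.sccs\<close>, which are
  induced subgraphs) are exactly the connected components.
\<close>

text \<open>The infimum over the empty set is \<open>\<infinity>\<close>, the distance between different components.\<close>

definition graph_dist :: "('a, 'b) pre_digraph \<Rightarrow> 'a \<Rightarrow> 'a \<Rightarrow> enat" where
  "graph_dist G u v = (INF p \<in> {p. pre_digraph.apath G u p v}. enat (length p))"

definition graph_diam :: "('a, 'b) pre_digraph \<Rightarrow> enat" where
  "graph_diam G = Max {graph_dist G u v | u v. u \<in> verts G \<and> v \<in> verts G}"

text \<open>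
  A matrix of a graph on \<open>n\<close> vertices depends on an enumeration
  \<open>x 0, \<dots>, x (n - 1)\<close> of the vertices.
\<close>

definition gen_dist_mat ::
    "nat \<Rightarrow> ('a, 'b) pre_digraph \<Rightarrow> (nat \<Rightarrow> 'a) \<Rightarrow> (nat \<Rightarrow> complex) \<Rightarrow> complex mat" where
  "gen_dist_mat n G x f =
     mat n n (\<lambda>(i, j). case graph_dist G (x i) (x j) of enat k \<Rightarrow> f k | \<infinity> \<Rightarrow> 0)"

definition exp_dist_mat ::
    "nat \<Rightarrow> ('a, 'b) pre_digraph \<Rightarrow> (nat \<Rightarrow> 'a) \<Rightarrow> complex \<Rightarrow> complex mat" where
  "exp_dist_mat n G x q =
     mat n n (\<lambda>(i, j). case graph_dist G (x i) (x j) of enat k \<Rightarrow> q ^ k | \<infinity> \<Rightarrow> 0)"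

text \<open>Eigenvalues are counted with algebraic multiplicity.\<close>

definition eigenvalue_mset :: "complex mat \<Rightarrow> complex multiset" where
  "eigenvalue_mset A = proots (char_poly A)"

definition cospectral :: "complex mat \<Rightarrow> complex mat \<Rightarrow> bool" where
  "cospectral A B \<longleftrightarrow> eigenvalue_mset A = eigenvalue_mset B"

end

theory Submission
  imports Defs
begin

text \<open>
  Grouping the entries of the matrices by distance, each entry of
  \<open>D\<^sub>f\<^sup>G S - S D\<^sub>f\<^sup>H\<close> is \<open>\<Sum>k\<le>d. c k * f k\<close>, with coefficients independent of \<open>f\<close>.
  The distance-zero matrices of \<open>G\<close> and \<open>H\<close> are both the identity, so \<open>c 0 = 0\<close>. Hence for
  \<open>f k = q ^ k\<close> the sum is a polynomial of degree at most \<open>d\<close> in \<open>q\<close> which vanishes at \<open>0\<close> and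
  at the \<open>d\<close> given values; all its coefficients are therefore zero.
\<close>

text \<open>A finite distance rules out the empty set of paths, whose infimum is
  \<open>\<infinity>\<close>. The lengths then form a nonempty subset of the well-ordered type
  \<open>enat\<close>, so the infimum is a minimum.\<close>

lemma graph_dist_attained:
  assumes "graph_dist G u v = enat k"
  obtains p where "pre_digraph.apath G u p v" "length p = k"
proof -
  let ?A = "(\<lambda>p. enat (length p)) ` {p. pre_digraph.apath G u p v}"
  have "?A \<noteq> {}"
    using assms by (metis Inf_empty graph_dist_def enat.distinct(1) top_enat_def)
  then have "Inf ?A \<in> ?A"
    by (meson ex_in_conv wellorder_InfI)
  then show thesis
    using assms that by (auto simp: graph_dist_def)
qed

lemma graph_dist_le_length:
  "pre_digraph.apath G u p v \<Longrightarrow> graph_dist G u v \<le> enat (length p)"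
  unfolding graph_dist_def by (rule INF_lower) simp

text \<open>The empty path joins only a vertex to itself. It needs \<open>u \<in> verts G\<close>:
  off the vertex set there are no paths, and the distance is \<open>\<infinity>\<close>.\<close>

lemma (in wf_digraph) graph_dist_eq_0_iff:
  assumes "u \<in> verts G"
  shows "graph_dist G u v = enat 0 \<longleftrightarrow> u = v"
proof
  assume "graph_dist G u v = enat 0"
  then show "u = v"
    by (metis apath_Nil_iff graph_dist_attained length_0_conv)
next
  assume "u = v"
  then have "apath u [] v"
    using assms by (simp add: apath_Nil_iff)
  then show "graph_dist G u v = enat 0"
    using graph_dist_le_length by (fastforce simp flip: zero_enat_def)
qed

lemma (in wf_digraph) graph_dist_le_subgraph:
  assumes "subgraph C G"
  shows "graph_dist G u v \<le> graph_dist C u v"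
  unfolding graph_dist_def
proof (rule INF_superset_mono)
  show "{p. pre_digraph.apath C u p v} \<subseteq> {p. apath u p v}"
    using assms by (auto intro: subgraph_apath_imp_apath)
qed simp

lemma graph_dist_le_graph_diam:
  assumes "finite (verts G)" "u \<in> verts G" "v \<in> verts G"
  shows "graph_dist G u v \<le> graph_diam G"
  unfolding graph_diam_def
proof (rule Max_ge)
  \<comment> \<open>\<open>Max\<close> is an upper bound only for finite sets; the image form makes
    finiteness visible.\<close>
  have "{graph_dist G u v |u v. u \<in> verts G \<and> v \<in> verts G} =
      (\<lambda>(u, v). graph_dist G u v) ` (verts G \<times> verts G)"
    by auto
  then show "finite {graph_dist G u v |u v. u \<in> verts G \<and> v \<in> verts G}"
    using assms by simp
qed (use assms in auto)

lemma (in fin_digraph) finite_sccs: "finite sccs"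
  unfolding sccs_conv_sccs_verts using finite_sccs_verts by simp

text \<open>Finite distance makes \<open>v\<close> reachable from \<open>u\<close>, so both lie in
  the component \<open>C\<close> induced by the vertices reachable from \<open>u\<close>. Paths of
  \<open>C\<close> are paths of \<open>G\<close>, hence \<open>k\<close> is at most the distance
  inside \<open>C\<close>, which is at most the diameter of \<open>C\<close>.\<close>

lemma (in graph) graph_dist_le_scc_diam:
  assumes "u \<in> verts G" and "graph_dist G u v = enat k"
  obtains C where "C \<in> sccs" "enat k \<le> graph_diam C"
proof
  let ?C = "G \<restriction> {w. u \<rightarrow>\<^sup>* w}"
  obtain p where "apath u p v"
    using assms(2) by (rule graph_dist_attained)
  then have uv: "u \<rightarrow>\<^sup>* v"
    using reachable_apath by blast
  show "?C \<in> sccs"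
    using assms(1) by (rule induce_reachable_is_in_sccs)
  then have sub: "subgraph ?C G"
    using in_sccs_imp_induced induced_imp_subgraph by blast
  then have "finite (verts ?C)"
    by (intro finite_subset[OF _ finite_verts]) (simp add: subgraph_def)
  then have "graph_dist ?C u v \<le> graph_diam ?C"
    using assms(1) uv by (intro graph_dist_le_graph_diam) auto
  then show "enat k \<le> graph_diam ?C"
    using graph_dist_le_subgraph[OF sub, of u v] assms(2) by simp
qed

text \<open>These are the entries of the distance-\<open>k\<close> matrix. A pair at distance
  \<open>\<infinity>\<close> gets 0 for every \<open>k\<close>, in agreement with the default entry
  of \<open>gen_dist_mat\<close>.\<close>

definition dist_indicator :: "('a, 'b) pre_digraph \<Rightarrow> nat \<Rightarrow> 'a \<Rightarrow> 'a \<Rightarrow> complex" where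
  "dist_indicator G k u v = of_bool (graph_dist G u v = enat k)"

lemma gen_dist_entry_eq_sum:
  assumes "\<And>k. graph_dist G u v = enat k \<Longrightarrow> k \<le> d"
  shows "(case graph_dist G u v of enat k \<Rightarrow> f k | \<infinity> \<Rightarrow> 0) =
    (\<Sum>k\<le>d. dist_indicator G k u v * f k)"
proof (cases "graph_dist G u v")
  case (enat m)
  then have "(\<Sum>k\<le>d. dist_indicator G k u v * f k) = (\<Sum>k\<le>d. if k = m then f k else 0)"
    by (intro sum.cong) (auto simp: dist_indicator_def)
  then show ?thesis
    using enat assms by simp
qed (simp add: dist_indicator_def)

lemma exp_dist_mat_eq_gen_dist_mat: "exp_dist_mat n G x q = gen_dist_mat n G x (\<lambda>k. q ^ k)"
  by (simp add: exp_dist_mat_def gen_dist_mat_def)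

lemma gen_dist_mat_carrier [simp]: "gen_dist_mat n G x f \<in> carrier_mat n n"
  by (simp add: gen_dist_mat_def)

text \<open>Interchanging the two sums isolates \<open>f\<close>: the coefficient of
  \<open>f k\<close> is an entry of the distance-\<open>k\<close> matrix times
  \<open>S\<close>.\<close>

lemma gen_dist_mat_mult_entry:
  assumes "S \<in> carrier_mat n n" "i < n" "j < n"
    and "\<And>l k. l < n \<Longrightarrow> graph_dist G (x i) (x l) = enat k \<Longrightarrow> k \<le> d"
  shows "(gen_dist_mat n G x f * S) $$ (i, j) =
    (\<Sum>k\<le>d. (\<Sum>l<n. dist_indicator G k (x i) (x l) * S $$ (l, j)) * f k)"
proof -
  have entry: "(case graph_dist G (x i) (x l) of enat k \<Rightarrow> f k | \<infinity> \<Rightarrow> 0) =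
      (\<Sum>k\<le>d. dist_indicator G k (x i) (x l) * f k)" if "l < n" for l
    using assms(4) that by (intro gen_dist_entry_eq_sum) blast
  have "(gen_dist_mat n G x f * S) $$ (i, j) =
      (\<Sum>l<n. (\<Sum>k\<le>d. dist_indicator G k (x i) (x l) * f k) * S $$ (l, j))"
    using assms(1-3)
    by (auto simp: gen_dist_mat_def scalar_prod_def entry lessThan_atLeast0 intro!: sum.cong)
  also have "\<dots> = (\<Sum>k\<le>d. (\<Sum>l<n. dist_indicator G k (x i) (x l) * S $$ (l, j)) * f k)"
    unfolding sum_distrib_right by (subst sum.swap) (simp add: mult_ac)
  finally show ?thesis .
qed

lemma mult_gen_dist_mat_entry:
  assumes "S \<in> carrier_mat n n" "i < n" "j < n"
    and "\<And>l k. l < n \<Longrightarrow> graph_dist G (x l) (x j) = enat k \<Longrightarrow> k \<le> d"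
  shows "(S * gen_dist_mat n G x f) $$ (i, j) =
    (\<Sum>k\<le>d. (\<Sum>l<n. S $$ (i, l) * dist_indicator G k (x l) (x j)) * f k)"
proof -
  have entry: "(case graph_dist G (x l) (x j) of enat k \<Rightarrow> f k | \<infinity> \<Rightarrow> 0) =
      (\<Sum>k\<le>d. dist_indicator G k (x l) (x j) * f k)" if "l < n" for l
    using assms(4) that by (intro gen_dist_entry_eq_sum) blast
  have "(S * gen_dist_mat n G x f) $$ (i, j) =
      (\<Sum>l<n. S $$ (i, l) * (\<Sum>k\<le>d. dist_indicator G k (x l) (x j) * f k))"
    using assms(1-3)
    by (auto simp: gen_dist_mat_def scalar_prod_def entry lessThan_atLeast0 intro!: sum.cong)
  also have "\<dots> = (\<Sum>k\<le>d. (\<Sum>l<n. S $$ (i, l) * dist_indicator G k (x l) (x j)) * f k)"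
    unfolding sum_distrib_right sum_distrib_left by (subst sum.swap) (simp add: mult_ac)
  finally show ?thesis .
qed

lemma dist_indicator_0_enum:
  assumes "wf_digraph G" "bij_betw x {..<n} (verts G)" "i < n" "j < n"
  shows "dist_indicator G 0 (x i) (x j) = of_bool (i = j)"
proof -
  have "x i \<in> verts G"
    using assms bij_betwE by blast
  moreover have "x i = x j \<longleftrightarrow> i = j"
    using assms by (auto simp: bij_betw_def inj_on_eq_iff)
  ultimately show ?thesis
    using wf_digraph.graph_dist_eq_0_iff[OF assms(1)] by (simp add: dist_indicator_def)
qed

text \<open>A nonzero coefficient would leave at most \<open>d\<close> roots, fewer than
  \<open>Q\<close> has elements.\<close>

lemma polyfun_coeffs_eq_0:
  fixes c :: "nat \<Rightarrow> complex"
  assumes "finite Q" "card Q > d" "\<And>q. q \<in> Q \<Longrightarrow> (\<Sum>k\<le>d. c k * q ^ k) = 0" "k \<le> d"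
  shows "c k = 0"
proof (rule ccontr)
  assume "c k \<noteq> 0"
  from polyfun_rootbound[of c k d, OF this \<open>k \<le> d\<close>]
  have "card Q \<le> d"
    using assms(3) card_mono[of "{z. (\<Sum>k\<le>d. c k * z ^ k) = 0}" Q] by fastforce
  with assms(2) show False by simp
qed

lemma char_poly_eq_of_intertwining:
  fixes A B S :: "'a :: comm_ring_1 mat"
  assumes A: "A \<in> carrier_mat n n" and B: "B \<in> carrier_mat n n" and S: "S \<in> carrier_mat n n"
    and "invertible_mat S" and AS: "A * S = S * B"
  shows "char_poly A = char_poly B"
proof -
  obtain T where T: "S * T = 1\<^sub>m n" "T * S = 1\<^sub>m (dim_row T)"
    using assms by (auto simp: invertible_mat_def inverts_mat_def)
  \<comment> \<open>\<open>invertible_mat\<close> does not state the size of the inverse; it is read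
    off from the dimensions of the two products.\<close>
  have "dim_col T = n" "dim_row T = n"
    using arg_cong[OF T(1), of dim_col] arg_cong[OF T(2), of dim_col] S by auto
  then have Tc: "T \<in> carrier_mat n n" and TS: "T * S = 1\<^sub>m n"
    using T(2) by auto
  have "A = A * (S * T)"
    using A T by simp
  also have "\<dots> = S * B * T"
    using A S Tc AS by (simp flip: assoc_mult_mat)
  finally have "similar_mat A B"
    using A B S Tc T(1) TS by (intro similar_matI[of _ _ S T n]) auto
  then show ?thesis
    by (rule char_poly_similar)
qed

theorem theorem4p1:
  fixes G :: "('a, 'b) pre_digraph" and H :: "('c, 'd) pre_digraph"
    and x :: "nat \<Rightarrow> 'a" and y :: "nat \<Rightarrow> 'c"
    and n d :: nat and S :: "complex mat" and Q :: "complex set"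
  assumes "graph G" and "graph H"
    and "bij_betw x {..<n} (verts G)" and "bij_betw y {..<n} (verts H)"
    and "enat d = Max (graph_diam ` pre_digraph.sccs G \<union> graph_diam ` pre_digraph.sccs H)"
    and "S \<in> carrier_mat n n" and "invertible_mat S"
    and "finite Q" and "card Q = d" and "0 \<notin> Q"
    and "\<forall>q \<in> Q. exp_dist_mat n G x q * S = S * exp_dist_mat n H y q"
  shows "\<forall>f :: nat \<Rightarrow> complex.
    gen_dist_mat n G x f * S = S * gen_dist_mat n H y f \<and>
    cospectral (gen_dist_mat n G x f) (gen_dist_mat n H y f)"
proof -
  interpret G: graph G by fact
  interpret H: graph H by fact
  have fin: "finite (graph_diam ` G.sccs \<union> graph_diam ` H.sccs)"
    using G.finite_sccs H.finite_sccs by simp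
  have boundG: "k \<le> d" if "i < n" "graph_dist G (x i) v = enat k" for i v k
  proof -
    have "x i \<in> verts G"
      using assms(3) \<open>i < n\<close> bij_betwE by blast
    then obtain C where "C \<in> G.sccs" "enat k \<le> graph_diam C"
      using G.graph_dist_le_scc_diam \<open>graph_dist G (x i) v = enat k\<close> by blast
    then have "enat k \<le> enat d"
      unfolding assms(5) using Max_ge[OF fin] by (meson UnI1 imageI order_trans)
    then show ?thesis by simp
  qed
  have boundH: "k \<le> d" if "i < n" "graph_dist H (y i) v = enat k" for i v k
  proof -
    have "y i \<in> verts H"
      using assms(4) \<open>i < n\<close> bij_betwE by blast
    then obtain C where "C \<in> H.sccs" "enat k \<le> graph_diam C"
      using H.graph_dist_le_scc_diam \<open>graph_dist H (y i) v = enat k\<close> by blast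
    then have "enat k \<le> enat d"
      unfolding assms(5) using Max_ge[OF fin] by (meson UnI2 imageI order_trans)
    then show ?thesis by simp
  qed
  \<comment> \<open>With \<open>A\<close> and \<open>B\<close> the distance-\<open>k\<close>
    matrices of \<open>G\<close> and \<open>H\<close>, this is entry \<open>(i, j)\<close> of
    \<open>A * S - S * B\<close>.\<close>
  define c where "c i j k = (\<Sum>l<n. dist_indicator G k (x i) (x l) * S $$ (l, j)) -
      (\<Sum>l<n. S $$ (i, l) * dist_indicator H k (y l) (y j))" for i j k
  have entry: "(gen_dist_mat n G x f * S) $$ (i, j) - (S * gen_dist_mat n H y f) $$ (i, j) =
      (\<Sum>k\<le>d. c i j k * f k)" if "i < n" "j < n" for i j f
    using that boundG boundH assms(6)
      gen_dist_mat_mult_entry[of S n i j G x d f] mult_gen_dist_mat_entry[of S n i j H y d f]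
    by (simp add: c_def left_diff_distrib sum_subtractf)
  have c_0: "c i j 0 = 0" if "i < n" "j < n" for i j
  proof -
    \<comment> \<open>Multiplying by the identity on either side leaves \<open>S $$ (i, j)\<close>,
      so the two sums cancel.\<close>
    have "(\<Sum>l<n. dist_indicator G 0 (x i) (x l) * S $$ (l, j)) =
        (\<Sum>l<n. if l = i then S $$ (l, j) else 0)"
      using that assms(3) G.wf_digraph_axioms
      by (intro sum.cong) (auto simp: dist_indicator_0_enum)
    moreover have "(\<Sum>l<n. S $$ (i, l) * dist_indicator H 0 (y l) (y j)) =
        (\<Sum>l<n. if l = j then S $$ (i, l) else 0)"
      using that assms(4) H.wf_digraph_axioms
      by (intro sum.cong) (auto simp: dist_indicator_0_enum)
    ultimately show ?thesis
      using that by (simp add: c_def)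
  qed
  have c_eq_0: "c i j k = 0" if ij: "i < n" "j < n" and "k \<le> d" for i j k
  proof (rule polyfun_coeffs_eq_0)
    \<comment> \<open>Degree at most \<open>d\<close> calls for \<open>d + 1\<close> roots; as
      \<open>0 \<notin> Q\<close>, adjoining 0 supplies the missing one.\<close>
    show "finite (insert 0 Q)" "card (insert 0 Q) > d"
      using assms by auto
    fix q assume "q \<in> insert 0 Q"
    then show "(\<Sum>k\<le>d. c i j k * q ^ k) = 0"
    proof
      assume "q = 0"
      then show ?thesis
        \<comment> \<open>As \<open>0 ^ 0 = 1\<close>, the value at 0 is the constant term
          \<open>c i j 0\<close>.\<close>
        using c_0[OF ij] by (intro sum.neutral) (auto simp: power_0_left)
    next
      assume "q \<in> Q"
      then show ?thesis
        using assms(11) entry[OF ij, of "\<lambda>k. q ^ k"] by (simp add: exp_dist_mat_eq_gen_dist_mat)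
    qed
  qed (fact \<open>k \<le> d\<close>)
  have intertwine: "gen_dist_mat n G x f * S = S * gen_dist_mat n H y f" for f
  proof (rule eq_matI)
    fix i j assume "i < dim_row (S * gen_dist_mat n H y f)" "j < dim_col (S * gen_dist_mat n H y f)"
    then have ij: "i < n" "j < n"
      using assms(6) by (auto simp: gen_dist_mat_def)
    show "(gen_dist_mat n G x f * S) $$ (i, j) = (S * gen_dist_mat n H y f) $$ (i, j)"
      using entry[OF ij, of f] c_eq_0[OF ij] by simp
  qed (use assms(6) in \<open>auto simp: gen_dist_mat_def\<close>)
  moreover have "cospectral (gen_dist_mat n G x f) (gen_dist_mat n H y f)" for f
    using char_poly_eq_of_intertwining[OF _ _ assms(6,7) intertwine]
    by (simp add: cospectral_def eigenvalue_mset_def)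
  ultimately show ?thesis
    by blast
qed

end
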